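(* Let $A\in\mathsf{S}^{k}(\mathbb{C}^{n})$. If $\operatorname{rank}_{\mathsf{S}}(A)=1$ or $\operatorname{rank}_{\mathsf{S}}(A)=2$, then $\operatorname{rank}(A)=\operatorname{rank}_{\mathsf{S}}(A)$.
   Context: $\mathsf{T}^k(\mathbb{C}^n)=\mathbb{C}^n\otimes\cdots\otimes\mathbb{C}^n$ ($k$ copies, $k\ge1$), and $\mathsf{S}^k(\mathbb{C}^n)$ is its subspace of symmetric tensors (invariant under all permutations of the $k$ tensor factors). For $A\in\mathsf{T}^k(\mathbb{C}^n)$, $\operatorname{rank}(A)$ is the least $r\ge 0$ such that $A=\sum_{i=1}^r \mathbf{u}_i^{(1)}\otimes\cdots\otimes\mathbf{u}_i^{(k)}$ with $\mathbf{u}_i^{(j)}\in\mathbb{C}^n$. For $A\in\mathsf{S}^k(\mathbb{C}^n)$, $\operatorname{rank}_{\mathsf{S}}(A)$ is the least $s\ge 0$ such that $A=\sum_{i=1}^s\mathbf{y}_i^{\otimes k}$ with $\mathbf{y}_i\in\mathbb{C}^n$, where $\mathbf{y}^{\otimes k}=\mathbf{y}\otimes\cdots\otimes\mathbf{y}$ ($k$ copies). The zero tensor has rank $0$. *)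

theory Defs
  imports "HOL-Analysis.Analysis" "HOL-Library.Extended_Nat"
begin

text \<open>
  An element of the \<open>k\<close>-fold tensor power of \<open>\<complex>\<^sup>n\<close> is represented by its coordinates in the
  basis formed by the tensor products of the standard basis vectors. The finite type \<open>'k\<close> labels
  the tensor factors and the finite type \<open>'n\<close> the coordinates of each factor, so that
  \<open>k = CARD('k) \<ge> 1\<close> and \<open>n = CARD('n) \<ge> 1\<close>. A multi-index is a function \<open>'k \<Rightarrow> 'n\<close>.
\<close>

type_synonym ('k, 'n) tensor = "complex ^ ('k \<Rightarrow> 'n)"

definition tensor_prod :: "('k::finite \<Rightarrow> complex ^ 'n::finite) \<Rightarrow> ('k, 'n) tensor" where
  "tensor_prod v = (\<chi> f. \<Prod>j\<in>UNIV. v j $ f j)"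

definition tensor_power :: "complex ^ 'n::finite \<Rightarrow> ('k::finite, 'n) tensor" where
  "tensor_power y = tensor_prod (\<lambda>_. y)"

text \<open>On decomposable tensors, permuting the factors by \<open>p\<close> moves factor \<open>j\<close> to position \<open>p j\<close>.\<close>

definition permute_factors ::
  "('k::finite \<Rightarrow> 'k) \<Rightarrow> ('k, 'n::finite) tensor \<Rightarrow> ('k, 'n) tensor" where
  "permute_factors p A = (\<chi> f. A $ (f \<circ> p))"

lemma permute_factors_tensor_prod:
  assumes "bij p"
  shows "permute_factors p (tensor_prod v) = tensor_prod (v \<circ> inv p)"
proof -
  have "(\<Prod>j\<in>UNIV. v j $ f (p j)) = (\<Prod>j\<in>UNIV. v (inv p j) $ f j)" for f
    using prod.reindex_bij_betw[OF assms, of "\<lambda>j. v (inv p j) $ f j"] assms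
    by (simp add: bij_is_inj)
  then show ?thesis
    by (simp add: permute_factors_def tensor_prod_def)
qed

definition symmetric_tensors :: "('k::finite, 'n::finite) tensor set" where
  "symmetric_tensors = {A. \<forall>p. bij p \<longrightarrow> permute_factors p A = A}"

text \<open>
  Both ranks are least lengths of decompositions, taken in \<^typ>\<open>enat\<close>: the infimum of a nonempty
  set of natural numbers is its least element, and it would be \<open>\<infinity>\<close> only for a tensor without any
  decomposition.
\<close>

definition tensor_rank :: "('k::finite, 'n::finite) tensor \<Rightarrow> enat" where
  "tensor_rank A =
     Inf {enat r |r. \<exists>u :: nat \<Rightarrow> 'k \<Rightarrow> complex ^ 'n. A = (\<Sum>i<r. tensor_prod (u i))}"

definition symmetric_rank :: "('k::finite, 'n::finite) tensor \<Rightarrow> enat" where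
  "symmetric_rank A =
     Inf {enat s |s. \<exists>y :: nat \<Rightarrow> complex ^ 'n. A = (\<Sum>i<s. tensor_power (y i))}"

end

theory Submission
  imports Defs
begin

text \<open>
  Since tensor powers are decomposable, the rank never exceeds the symmetric rank. If the rank is
  strictly smaller than a symmetric rank of at most two, then it is zero or one, so it suffices
  that a symmetric tensor of rank at most one has symmetric rank no larger than its rank. For the
  zero tensor this holds by the empty decomposition. For a nonzero symmetric
  \<open>u\<^sub>1 \<otimes> \<dots> \<otimes> u\<^sub>k\<close>, invariance under transpositions forces all \<open>u\<^sub>j\<close> to be multiples of one vector
  \<open>y\<close>, so the tensor is \<open>c y \<otimes> \<dots> \<otimes> y\<close>; the scalar \<open>c\<close> can be absorbed into \<open>y\<close> because it has a
  complex \<open>k\<close>-th root. This is lemma \<open>symmetric_tensor_prod_is_power\<close>.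
\<close>

text \<open>
  The symmetry is tested on entries that agree with a nonzero entry \<open>f\<close> away from the positions
  \<open>i\<close> and \<open>j\<close>: the factors common to both sides are then nonzero and cancel.
\<close>

lemma symmetric_tensor_prod_proportional:
  fixes u :: "'k::finite \<Rightarrow> complex ^ 'n::finite"
  assumes sym: "tensor_prod u \<in> symmetric_tensors"
    and nz: "\<And>l. u l $ f l \<noteq> 0"
  shows "u i $ a * u j $ b = u i $ b * u j $ a"
proof (cases "i = j")
  case False
  define g where "g = f(i := a, j := b)"
  define R where "R = (\<Prod>l\<in>UNIV - {i, j}. u l $ f l)"
  have split: "(\<Prod>l\<in>UNIV. u l $ h l) = u i $ h i * u j $ h j * R"
    if "\<And>l. l \<noteq> i \<Longrightarrow> l \<noteq> j \<Longrightarrow> h l = f l" for h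
  proof -
    have "(\<Prod>l\<in>UNIV. u l $ h l) = (\<Prod>l\<in>UNIV - {i, j}. u l $ h l) * (\<Prod>l\<in>{i, j}. u l $ h l)"
      by (rule prod.subset_diff) auto
    also have "(\<Prod>l\<in>UNIV - {i, j}. u l $ h l) = R"
      unfolding R_def by (rule prod.cong) (auto simp: that)
    finally show ?thesis
      using False by simp
  qed
  have "permute_factors (Transposition.transpose i j) (tensor_prod u) = tensor_prod u"
    using sym by (simp add: symmetric_tensors_def)
  then have "permute_factors (Transposition.transpose i j) (tensor_prod u) $ g = tensor_prod u $ g"
    by simp
  then have "(\<Prod>l\<in>UNIV. u l $ (g \<circ> Transposition.transpose i j) l) = (\<Prod>l\<in>UNIV. u l $ g l)"
    by (simp add: permute_factors_def tensor_prod_def)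
  moreover have "(\<Prod>l\<in>UNIV. u l $ (g \<circ> Transposition.transpose i j) l) = u i $ b * u j $ a * R"
    using False by (subst split) (auto simp: g_def Transposition.transpose_def)
  moreover have "(\<Prod>l\<in>UNIV. u l $ g l) = u i $ a * u j $ b * R"
    using False by (subst split) (auto simp: g_def)
  moreover have "R \<noteq> 0"
    using nz by (simp add: R_def)
  ultimately show ?thesis
    by simp
qed simp

lemma tensor_prod_scaled_copies:
  "tensor_prod (\<lambda>j. c j *s y) $ g = (\<Prod>j\<in>UNIV. c j) * tensor_power y $ g"
  by (simp add: tensor_prod_def tensor_power_def prod.distrib)

text \<open>
  In the nonzero case every \<open>u j\<close> is a multiple of a single \<open>u i\<close>, and both the root extraction and,
  in the zero case, the identity \<open>0 = 0 \<otimes> \<dots> \<otimes> 0\<close> rest on there being at least one factor.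
\<close>

lemma symmetric_tensor_prod_is_power:
  fixes u :: "'k::finite \<Rightarrow> complex ^ 'n::finite"
  assumes sym: "tensor_prod u \<in> symmetric_tensors"
  obtains y where "tensor_prod u = tensor_power y"
proof (cases "tensor_prod u = 0")
  case True
  then have "tensor_prod u = tensor_power 0"
    by (simp add: tensor_power_def tensor_prod_def vec_eq_iff[of 0] power_0_left)
  then show ?thesis
    by (rule that)
next
  case False
  then obtain f where "tensor_prod u $ f \<noteq> 0"
    by (auto simp: vec_eq_iff)
  then have nz: "u l $ f l \<noteq> 0" for l
    by (simp add: tensor_prod_def)
  fix i :: 'k
  define c where "c j = u j $ f i / u i $ f i" for j
  have "u = (\<lambda>j. c j *s u i)"
  proof (rule ext)
    show "u j = c j *s u i" for j
      using symmetric_tensor_prod_proportional[OF sym nz, of i _ j "f i"] nz[of i]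
      by (simp add: vec_eq_iff c_def field_simps)
  qed
  then have scaled: "tensor_prod u = tensor_prod (\<lambda>j. c j *s u i)"
    by (rule arg_cong[of _ _ tensor_prod])
  obtain z :: complex where z: "(\<Prod>j\<in>UNIV. c j) = z ^ CARD('k)"
    using exists_complex_root[OF zero_less_card_finite[THEN less_imp_neq, symmetric]] .
  have "tensor_prod u = tensor_prod (\<lambda>_. z *s u i)"
  proof (rule vec_eq_iff[THEN iffD2, rule_format])
    fix g
    have "tensor_prod u $ g = z ^ CARD('k) * tensor_power (u i) $ g"
      by (simp only: scaled tensor_prod_scaled_copies z)
    also have "\<dots> = tensor_prod (\<lambda>_. z *s u i) $ g"
      by (simp only: tensor_prod_scaled_copies prod_constant)
    finally show "tensor_prod u $ g = tensor_prod (\<lambda>_. z *s u i) $ g" .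
  qed
  then have "tensor_prod u = tensor_power (z *s u i)"
    by (simp only: tensor_power_def)
  then show ?thesis
    by (rule that)
qed

lemma tensor_rank_le:
  assumes "A = (\<Sum>i<r. tensor_prod (u i))"
  shows "tensor_rank A \<le> enat r"
  unfolding tensor_rank_def using assms by (intro Inf_lower) blast

lemma tensor_rank_le_symmetric_rank: "tensor_rank A \<le> symmetric_rank A"
  unfolding symmetric_rank_def tensor_power_def
  by (rule Inf_greatest) (auto intro: tensor_rank_le)

text \<open>
  A set of extended naturals with finite infimum is nonempty, and by well-ordering the infimum of a
  nonempty set is attained.
\<close>

lemma tensor_rank_decomposition:
  assumes "tensor_rank A = enat r"
  obtains u where "A = (\<Sum>i<r. tensor_prod (u i))"
proof -
  let ?S = "{enat r |r. \<exists>u. A = (\<Sum>i<r. tensor_prod (u i))}"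
  have "?S \<noteq> {}"
    using assms by (auto simp: tensor_rank_def Inf_enat_def simp del: Collect_empty_eq split: if_splits)
  then have "tensor_rank A \<in> ?S"
    unfolding tensor_rank_def by (meson ex_in_conv wellorder_InfI)
  then show ?thesis
    using assms that by auto
qed

lemma symmetric_rank_le:
  assumes "A = (\<Sum>i<s. tensor_power (y i))"
  shows "symmetric_rank A \<le> enat s"
  unfolding symmetric_rank_def using assms by (intro Inf_lower) blast

lemma symmetric_rank_eq_if_tensor_rank_le_1:
  assumes sym: "A \<in> symmetric_tensors" and le: "tensor_rank A \<le> 1"
  shows "symmetric_rank A = tensor_rank A"
proof -
  obtain r where r: "tensor_rank A = enat r" "r \<le> 1"
    using le by (cases "tensor_rank A") (auto simp: one_enat_def)
  obtain u where u: "A = (\<Sum>i<r. tensor_prod (u i))"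
    using r(1) by (rule tensor_rank_decomposition)
  have "\<exists>y. A = (\<Sum>i<r. tensor_power (y i))"
  proof (cases "r = 0")
    case False
    then have [simp]: "r = 1"
      using r(2) by simp
    have "A = tensor_prod (u 0)"
      using u by simp
    then obtain y where "A = tensor_power y"
      using sym symmetric_tensor_prod_is_power by metis
    then show ?thesis
      by auto
  qed (use u in simp)
  then have "symmetric_rank A \<le> tensor_rank A"
    using r(1) symmetric_rank_le by auto
  then show ?thesis
    using tensor_rank_le_symmetric_rank by (rule antisym)
qed

theorem proposition5p5:
  fixes A :: "('k::finite, 'n::finite) tensor"
  assumes "A \<in> symmetric_tensors"
    and "symmetric_rank A = 1 \<or> symmetric_rank A = 2"
  shows "tensor_rank A = symmetric_rank A"
proof (rule ccontr)
  assume "tensor_rank A \<noteq> symmetric_rank A"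
  then have "tensor_rank A < symmetric_rank A"
    by (simp add: order_less_le tensor_rank_le_symmetric_rank)
  also have "symmetric_rank A \<le> eSuc 1"
    using assms(2) by (auto simp: eSuc_plus_1)
  finally have "tensor_rank A \<le> 1"
    by (cases "tensor_rank A") simp_all
  then show False
    using symmetric_rank_eq_if_tensor_rank_le_1[OF assms(1)] \<open>tensor_rank A \<noteq> symmetric_rank A\<close>
    by simp
qed

end
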